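(* Let $(X,d)$ be a metric space, $p\in[1,\infty]$, $x_1,\dots,x_L\in X$, $F\subseteq X$ nonempty, and $\alpha\ge1$. For each $\ell\in[L]$ let $x'_\ell\in F$ satisfy $d(x_\ell,x'_\ell)\le\alpha\, d(x_\ell,y)$ for all $y\in F$ (an $\alpha$-approximate solution of the closest-candidate problem for $x_\ell$ and $F$). Let $f(x)=\big(\sum_{\ell\in[L]}d(x,x_\ell)^p\big)^{1/p}$ if $p<\infty$ and $f(x)=\max_{\ell\in[L]}d(x,x_\ell)$ if $p=\infty$, and let $x_{\mathrm{out}}\in\arg\min_{x\in\{x'_1,\dots,x'_L\}}f(x)$. Then $f(x_{\mathrm{out}})\le(\alpha+2)f(x)$ for every $x\in F$; that is, this procedure (Algorithm 2) is an $(\alpha+2)$-approximation algorithm for minimizing $f$ over $F$.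
   Context: The problem Find the Most Representative Candidate in a Metric Space asks, given a metric space $(X,d)$, points $x_1,\dots,x_L\in X$ and a candidate set $F\subseteq X$, for $x\in F$ minimizing $f(x)$ as defined in the claim. The subproblem Find the Closest Candidate asks, given $x\in X$ and $F\subseteq X$, for $x'\in F$ minimizing $d(x,x')$. *)

theory Defs
  imports "HOL-Analysis.Abstract_Metric_Spaces" "HOL-Library.Extended_Real"
begin

text \<open>For \<^term>\<open>L = 0\<close> and \<^term>\<open>p = \<infinity>\<close> the value is the unspecified maximum of the empty set.\<close>

definition rep_cost :: "('a \<Rightarrow> 'a \<Rightarrow> real) \<Rightarrow> ereal \<Rightarrow> nat \<Rightarrow> (nat \<Rightarrow> 'a) \<Rightarrow> 'a \<Rightarrow> real" where
  "rep_cost d p L xs x =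
     (if p = \<infinity> then Max ((\<lambda>l. d x (xs l)) ` {1..L})
      else (\<Sum>l\<in>{1..L}. d x (xs l) powr real_of_ereal p) powr (1 / real_of_ereal p))"

end

theory Submission
  imports Defs
begin

text \<open>
  Let \<open>k\<close> index the point closest to \<open>x\<close> among the given ones. By the triangle inequality through
  \<open>xs k\<close> and \<open>x\<close>, every distance \<open>d (xs' k) (xs l)\<close> is at most
  \<open>(\<alpha> + 1) * d x (xs k) + d x (xs l) \<le> (\<alpha> + 2) * d x (xs l)\<close>. As this holds for each \<open>l\<close>
  separately, the bound passes to the cost for every exponent without Minkowski's inequality.
\<close>

text \<open>For every exponent the cost is monotone in each distance and positively homogeneous of
  degree one in the tuple of distances, so a factor common to all entries can be pulled out.\<close>

lemma rep_cost_le_scaled: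
  assumes "1 \<le> p" and "0 < L" and "0 \<le> c"
    and nonneg: "\<And>l. l \<in> {1..L} \<Longrightarrow> 0 \<le> d x (xs l)" "\<And>l. l \<in> {1..L} \<Longrightarrow> 0 \<le> d y (xs l)"
    and le: "\<And>l. l \<in> {1..L} \<Longrightarrow> d y (xs l) \<le> c * d x (xs l)"
  shows "rep_cost d p L xs y \<le> c * rep_cost d p L xs x"
proof (cases "p = \<infinity>")
  case True
  have "d y (xs l) \<le> c * Max ((\<lambda>l. d x (xs l)) ` {1..L})" if "l \<in> {1..L}" for l
  proof -
    have "d x (xs l) \<le> Max ((\<lambda>l. d x (xs l)) ` {1..L})"
      using that by (intro Max_ge) auto
    then show ?thesis
      using le[OF that] \<open>0 \<le> c\<close> mult_left_mono order_trans by blast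
  qed
  \<comment> \<open>\<open>0 < L\<close> keeps \<open>Max\<close> off the empty set, where its value
    is unspecified and bounds on the entries would say nothing.\<close>
  then show ?thesis
    using True \<open>0 < L\<close> by (auto simp: rep_cost_def)
next
  case False
  define q where "q = real_of_ereal p"
  \<comment> \<open>\<open>real_of_ereal\<close> sends both infinities to 0; the case excludes one
    and \<open>1 \<le> p\<close> the other.\<close>
  have "1 \<le> q"
    using False \<open>1 \<le> p\<close> by (cases p) (auto simp: q_def one_ereal_def)
  have "(\<Sum>l\<in>{1..L}. d y (xs l) powr q) \<le> (\<Sum>l\<in>{1..L}. c powr q * d x (xs l) powr q)"
  proof (rule sum_mono)
    fix l assume l: "l \<in> {1..L}"
    have "d y (xs l) powr q \<le> (c * d x (xs l)) powr q"
      using le[OF l] nonneg[OF l] \<open>1 \<le> q\<close> by (intro powr_mono2) auto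
    then show "d y (xs l) powr q \<le> c powr q * d x (xs l) powr q"
      using nonneg[OF l] \<open>0 \<le> c\<close> by (simp add: powr_mult)
  qed
  then have "(\<Sum>l\<in>{1..L}. d y (xs l) powr q) powr (1 / q)
      \<le> (c powr q * (\<Sum>l\<in>{1..L}. d x (xs l) powr q)) powr (1 / q)"
    using \<open>1 \<le> q\<close> by (intro powr_mono2) (auto simp: sum_distrib_left intro: sum_nonneg)
  \<comment> \<open>The exponents q and 1 / q cancel on c, also for c = 0 because
    \<open>0 powr q = 0\<close>.\<close>
  also have "\<dots> = c * (\<Sum>l\<in>{1..L}. d x (xs l) powr q) powr (1 / q)"
    using \<open>1 \<le> q\<close> \<open>0 \<le> c\<close> by (simp add: powr_mult powr_powr sum_nonneg)
  finally show ?thesis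
    using False by (simp add: rep_cost_def q_def)
qed

theorem theorem2:
  fixes X :: "'a set" and d :: "'a \<Rightarrow> 'a \<Rightarrow> real" and p :: ereal and L :: nat
    and xs xs' :: "nat \<Rightarrow> 'a" and F :: "'a set" and \<alpha> :: real and xout :: 'a
  assumes "Metric_space X d"
    and "1 \<le> p"
    and "\<And>l. l \<in> {1..L} \<Longrightarrow> xs l \<in> X"
    and "F \<subseteq> X" and "F \<noteq> {}"
    and "1 \<le> \<alpha>"
    and "\<And>l. l \<in> {1..L} \<Longrightarrow> xs' l \<in> F"
    and "\<And>l y. l \<in> {1..L} \<Longrightarrow> y \<in> F \<Longrightarrow> d (xs l) (xs' l) \<le> \<alpha> * d (xs l) y"
    and "is_arg_min (rep_cost d p L xs) (\<lambda>y. y \<in> xs' ` {1..L}) xout"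
  shows "xout \<in> F \<and> (\<forall>x\<in>F. rep_cost d p L xs xout \<le> (\<alpha> + 2) * rep_cost d p L xs x)"
proof (intro conjI ballI)
  interpret Metric_space X d by fact
  from assms(9) have out: "xout \<in> xs' ` {1..L}"
    and out_le: "\<And>l. l \<in> {1..L} \<Longrightarrow> rep_cost d p L xs xout \<le> rep_cost d p L xs (xs' l)"
    by (auto simp: is_arg_min_linorder)
  show "xout \<in> F"
    using out assms(7) by auto
  fix x assume "x \<in> F"
  then have "x \<in> X"
    using \<open>F \<subseteq> X\<close> by auto
  \<comment> \<open>The existence of the minimizer \<open>xout\<close> rules out L = 0.\<close>
  have ne: "{1..L} \<noteq> {}"
    using out by auto
  \<comment> \<open>This k depends on x, which the procedure does not know; minimizing over all
    \<open>xs' l\<close> covers whichever k arises.\<close>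
  obtain k where k: "k \<in> {1..L}" and closest: "\<And>l. l \<in> {1..L} \<Longrightarrow> d x (xs k) \<le> d x (xs l)"
    using arg_min_if_finite[OF finite_atLeastAtMost ne, of "\<lambda>l. d x (xs l)"] by (meson not_le)
  have "xs k \<in> X" "xs' k \<in> X"
    using k assms(3,4,7) by auto
  have "d (xs' k) (xs l) \<le> (\<alpha> + 2) * d x (xs l)" if l: "l \<in> {1..L}" for l
  proof -
    have "xs l \<in> X"
      using l assms(3) by auto
    have "d (xs' k) (xs l) \<le> d (xs k) (xs' k) + d x (xs k) + d x (xs l)"
      using triangle[OF \<open>xs' k \<in> X\<close> \<open>xs k \<in> X\<close> \<open>xs l \<in> X\<close>]
        triangle[OF \<open>xs k \<in> X\<close> \<open>x \<in> X\<close> \<open>xs l \<in> X\<close>] by (simp add: commute)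
    \<comment> \<open>The approximation guarantee at k is applied with x itself as the competitor,
      which is admissible since x lies in F.\<close>
    also have "\<dots> \<le> (\<alpha> + 1) * d x (xs k) + d x (xs l)"
      using assms(8)[OF k \<open>x \<in> F\<close>] by (simp add: commute algebra_simps)
    also have "\<dots> \<le> (\<alpha> + 1) * d x (xs l) + d x (xs l)"
      using closest[OF l] \<open>1 \<le> \<alpha>\<close> by (simp add: mult_left_mono)
    finally show ?thesis
      by (simp add: algebra_simps)
  qed
  then have "rep_cost d p L xs (xs' k) \<le> (\<alpha> + 2) * rep_cost d p L xs x"
    using ne \<open>1 \<le> p\<close> \<open>1 \<le> \<alpha>\<close> by (intro rep_cost_le_scaled) auto
  then show "rep_cost d p L xs xout \<le> (\<alpha> + 2) * rep_cost d p L xs x"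
    using out_le[OF k] by linarith
qed

end
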